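(* Let $D$ be an integral domain that is not a field, and suppose that $D$ satisfies ACCP (the ascending chain condition on principal ideals). Then (1) $D$ is a PID if and only if $I(D)\vartriangleleft P$ for $P=$ "is a proper nonzero principal ideal"; (2) $D$ is a UFD if and only if $I_t(D)\vartriangleleft P$ for $P=$ "is a proper nonzero principal ideal".
   Context: Let $K$ be the quotient field of $D$. For a nonzero fractional ideal $I$ of $D$: $I^{-1}=\{x\in K: xI\subseteq D\}$, $I_v=(I^{-1})^{-1}$, and $I_t=\bigcup\{J_v: J\subseteq I \text{ a nonzero finitely generated ideal}\}$. $I$ is a $t$-ideal if $I=I_t$. $I(D)$ is the set of nonzero proper integral ideals of $D$, and $I_t(D)$ is the set of (nonzero) proper integral $t$-ideals of $D$. For $S(D)=I(D)$ or $I_t(D)$ and a property $P$ of ideals, $S(D)\vartriangleleft P$ means that every $s\in S(D)$ is contained in some $\gamma\in S(D)$ satisfying $P$. *)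

theory Defs
  imports "HOL-Algebra.Algebra"
begin

text \<open>
  A quotient field of an integral domain \<open>D\<close> is given by a field \<open>K\<close> and an embedding
  \<open>h\<close> of \<open>D\<close> into \<open>K\<close> such that every element of \<open>K\<close> is a fraction of elements of \<open>D\<close>.
  Fractional ideals are subsets of \<open>K\<close>, integral ideals are subsets of \<open>D\<close>; an integral ideal
  \<open>I\<close> is regarded as the fractional ideal \<open>h ` I\<close>.
\<close>

locale quotient_field = D?: domain D + K?: field K
  for D (structure) and K (structure) and h +
  assumes embedding: "h \<in> ring_hom D K"
    and embedding_inj: "inj_on h (carrier D)"
    and fractions: "x \<in> carrier K \<Longrightarrow>
      \<exists>a \<in> carrier D. \<exists>b \<in> carrier D - {\<zero>\<^bsub>D\<^esub>}. x = h a \<otimes>\<^bsub>K\<^esub> inv\<^bsub>K\<^esub> (h b)"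

definition D_submodule ::
  "('a, 'c) ring_scheme \<Rightarrow> ('b, 'd) ring_scheme \<Rightarrow> ('a \<Rightarrow> 'b) \<Rightarrow> 'b set \<Rightarrow> bool" where
  "D_submodule D K h M \<longleftrightarrow>
    additive_subgroup M K \<and> (\<forall>d \<in> carrier D. \<forall>x \<in> M. h d \<otimes>\<^bsub>K\<^esub> x \<in> M)"

definition fractional_ideal ::
  "('a, 'c) ring_scheme \<Rightarrow> ('b, 'd) ring_scheme \<Rightarrow> ('a \<Rightarrow> 'b) \<Rightarrow> 'b set \<Rightarrow> bool" where
  "fractional_ideal D K h I \<longleftrightarrow> D_submodule D K h I \<and>
    (\<exists>d \<in> carrier D - {\<zero>\<^bsub>D\<^esub>}. \<forall>x \<in> I. h d \<otimes>\<^bsub>K\<^esub> x \<in> h ` carrier D)"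

definition finitely_generated ::
  "('a, 'c) ring_scheme \<Rightarrow> ('b, 'd) ring_scheme \<Rightarrow> ('a \<Rightarrow> 'b) \<Rightarrow> 'b set \<Rightarrow> bool" where
  "finitely_generated D K h J \<longleftrightarrow>
    (\<exists>A. finite A \<and> A \<subseteq> carrier K \<and> J = \<Inter> {M. D_submodule D K h M \<and> A \<subseteq> M})"

definition frac_inverse ::
  "('a, 'c) ring_scheme \<Rightarrow> ('b, 'd) ring_scheme \<Rightarrow> ('a \<Rightarrow> 'b) \<Rightarrow> 'b set \<Rightarrow> 'b set" where
  "frac_inverse D K h I = {x \<in> carrier K. \<forall>y \<in> I. x \<otimes>\<^bsub>K\<^esub> y \<in> h ` carrier D}"

definition v_closure ::
  "('a, 'c) ring_scheme \<Rightarrow> ('b, 'd) ring_scheme \<Rightarrow> ('a \<Rightarrow> 'b) \<Rightarrow> 'b set \<Rightarrow> 'b set" where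
  "v_closure D K h I = frac_inverse D K h (frac_inverse D K h I)"

definition t_closure ::
  "('a, 'c) ring_scheme \<Rightarrow> ('b, 'd) ring_scheme \<Rightarrow> ('a \<Rightarrow> 'b) \<Rightarrow> 'b set \<Rightarrow> 'b set" where
  "t_closure D K h I = \<Union> {v_closure D K h J | J. J \<subseteq> I \<and> J \<noteq> {\<zero>\<^bsub>K\<^esub>} \<and>
     fractional_ideal D K h J \<and> finitely_generated D K h J}"

definition t_ideal ::
  "('a, 'c) ring_scheme \<Rightarrow> ('b, 'd) ring_scheme \<Rightarrow> ('a \<Rightarrow> 'b) \<Rightarrow> 'b set \<Rightarrow> bool" where
  "t_ideal D K h I \<longleftrightarrow>
    fractional_ideal D K h I \<and> I \<noteq> {\<zero>\<^bsub>K\<^esub>} \<and> t_closure D K h I = I"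

definition integral_ideals :: "('a, 'c) ring_scheme \<Rightarrow> 'a set set" where
  "integral_ideals D = {I. ideal I D \<and> I \<noteq> {\<zero>\<^bsub>D\<^esub>} \<and> I \<noteq> carrier D}"

definition integral_t_ideals ::
  "('a, 'c) ring_scheme \<Rightarrow> ('b, 'd) ring_scheme \<Rightarrow> ('a \<Rightarrow> 'b) \<Rightarrow> 'a set set" where
  "integral_t_ideals D K h = {I \<in> integral_ideals D. t_ideal D K h (h ` I)}"

definition covered_by :: "'a set set \<Rightarrow> ('a set \<Rightarrow> bool) \<Rightarrow> bool" (infix \<open>\<lhd>\<^sub>P\<close> 50) where
  "S \<lhd>\<^sub>P P \<longleftrightarrow> (\<forall>s \<in> S. \<exists>\<gamma> \<in> S. s \<subseteq> \<gamma> \<and> P \<gamma>)"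

definition proper_nonzero_principal :: "('a, 'c) ring_scheme \<Rightarrow> 'a set \<Rightarrow> bool" where
  "proper_nonzero_principal D I \<longleftrightarrow> principalideal I D \<and> I \<noteq> {\<zero>\<^bsub>D\<^esub>} \<and> I \<noteq> carrier D"

definition ACCP :: "('a, 'c) ring_scheme \<Rightarrow> bool" where
  "ACCP D \<longleftrightarrow> (\<forall>C :: nat \<Rightarrow> 'a set.
    (\<forall>n. principalideal (C n) D \<and> C n \<subseteq> C (Suc n)) \<longrightarrow> (\<exists>N. \<forall>n \<ge> N. C n = C N))"

end

theory Submission
  imports Defs
begin

text \<open>
  ACCP makes proper divisibility well-founded. For the PID part, let \<open>x \<noteq> 0\<close> be an element of an
  ideal \<open>I\<close>. If \<open>I \<subseteq> aD\<close> with \<open>a\<close> a nonunit, then \<open>a\<^sup>-\<^sup>1I\<close> is an ideal of \<open>D\<close> containing the proper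
  divisor \<open>x/a\<close> of \<open>x\<close>, so \<open>I\<close> is principal by induction on \<open>x\<close>.

  For the UFD part, suppose first that irreducibles are prime and that no \<open>pD\<close>, with \<open>p\<close> a prime divisor
  of \<open>x \<in> I\<close>, contains \<open>I\<close>. Then there is a finite \<open>Y \<subseteq> I\<close> such that \<open>x\<close> and \<open>Y\<close> generate an ideal whose
  v-closure is \<open>D\<close>, so the t-ideal \<open>I\<close> is not proper. Conversely, let \<open>p\<close> be irreducible with
  \<open>p | ab\<close>, and consider the t-ideal \<open>(p, a)\<^sub>v\<close>. If it is proper, it lies in some \<open>cD\<close> with \<open>c\<close> a nonunit,
  and \<open>c\<close> is associated to \<open>p\<close>, so \<open>p | a\<close>. If it is \<open>D\<close>, then \<open>b/p \<in> (p, a)\<^sup>-\<^sup>1 = D\<close>, so \<open>p | b\<close>.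
\<close>

section \<open>Divisor chains\<close>

context domain
begin

text \<open>Divisibility reverses inclusion of principal ideals, so an infinite descent through
  proper factors is a strictly ascending chain, which ACCP forbids.\<close>

lemma ACCP_imp_divisor_chain_condition:
  assumes "ACCP R"
  shows "divisor_chain_condition_monoid (mult_of R)"
proof unfold_locales
  let ?r = "{(x, y). x \<in> carrier (mult_of R) \<and> y \<in> carrier (mult_of R) \<and>
    properfactor (mult_of R) x y}"
  show "wf ?r"
    unfolding wf_iff_no_infinite_down_chain
  proof
    assume "\<exists>f. \<forall>i. (f (Suc i), f i) \<in> ?r"
    then obtain f where f: "\<And>i. (f (Suc i), f i) \<in> ?r"
      by blast
    have carr: "f i \<in> carrier R" for i
      using f[of i] by auto
    have dvd: "f (Suc i) divides f i" for i
      using f[of i] by (auto simp: properfactor_def)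
    \<comment> \<open>Proper factors are taken in \<open>mult_of R\<close>; the failure of
      divisibility has to be carried back to \<open>R\<close>, where the principal ideals
      live.\<close>
    have not_dvd: "\<not> f i divides f (Suc i)" for i
      using f[of i] divides_imp_divides_mult[of "f i" "f (Suc i)"]
      by (auto simp: properfactor_def)
    have "\<forall>n. principalideal (PIdl (f n)) R \<and> PIdl (f n) \<subseteq> PIdl (f (Suc n))"
      using carr dvd to_contain_is_to_divide cgenideal_is_principalideal by blast
    then obtain N where "\<forall>n \<ge> N. PIdl (f n) = PIdl (f N)"
      using assms[unfolded ACCP_def, THEN spec, of "\<lambda>n. PIdl (f n)"] by auto
    then have "PIdl (f (Suc N)) \<subseteq> PIdl (f N)"
      by (metis le_SucI order_refl)
    then show False
      using carr not_dvd to_contain_is_to_divide by blast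
  qed
qed

text \<open>Supplies the descent in both inductions below, which pass from an element to its
  cofactor by a nonunit.\<close>

lemma properfactor_mult_nonunit:
  assumes "a \<in> carrier R" "b \<in> carrier R" "a \<otimes> b \<noteq> \<zero>" "a \<notin> Units R"
  shows "properfactor (mult_of R) b (a \<otimes> b)"
proof (rule mult_of.properfactorI3[of _ _ a])
  show "a \<otimes> b = b \<otimes> a"
    using assms m_comm by simp
qed (use assms in auto)

section \<open>Covers by principal ideals and the PID criterion\<close>

lemma ideal_divided_by:
  assumes "ideal I R" "a \<in> carrier R"
  shows "ideal {d \<in> carrier R. a \<otimes> d \<in> I} R"
proof -
  interpret I: ideal I R by fact
  show ?thesis
  proof (intro idealI ring_axioms add.subgroupI)
    show "{d \<in> carrier R. a \<otimes> d \<in> I} \<noteq> {}"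
      using assms(2) I.zero_closed by (auto intro!: exI[of _ \<zero>])
  next
    fix d assume d: "d \<in> {d \<in> carrier R. a \<otimes> d \<in> I}"
    then have "a \<otimes> (\<ominus> d) = \<ominus> (a \<otimes> d)"
      using assms(2) r_minus by auto
    then show "\<ominus>\<^bsub>R\<^esub> d \<in> {d \<in> carrier R. a \<otimes> d \<in> I}"
      using d by simp
  next
    fix d x assume d: "d \<in> {d \<in> carrier R. a \<otimes> d \<in> I}" and x: "x \<in> carrier R"
    then have "a \<otimes> (d \<otimes> x) \<in> I"
      using assms(2) I.I_r_closed[of "a \<otimes> d" x] by (simp add: m_assoc)
    then show "x \<otimes> d \<in> {d \<in> carrier R. a \<otimes> d \<in> I}" "d \<otimes> x \<in> {d \<in> carrier R. a \<otimes> d \<in> I}"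
      using d x by (auto simp: m_comm)
  qed (use assms(2) in \<open>auto simp: r_distr\<close>)
qed

lemma proper_nonzero_principal_iff:
  "proper_nonzero_principal R I \<longleftrightarrow> (\<exists>a \<in> carrier R - {\<zero>} - Units R. I = PIdl a)"
proof
  assume "proper_nonzero_principal R I"
  then interpret principalideal I R
    by (simp add: proper_nonzero_principal_def)
  obtain a where a: "a \<in> carrier R" "I = PIdl a"
    using generate cgenideal_eq_genideal by auto
  moreover have "PIdl \<zero> = {\<zero>}"
    by (auto simp: cgenideal_def intro!: exI[of _ \<zero>])
  ultimately show "\<exists>a \<in> carrier R - {\<zero>} - Units R. I = PIdl a"
    using \<open>proper_nonzero_principal R I\<close> ideal_eq_carrier_iff[of a]
    by (auto simp: proper_nonzero_principal_def)
next
  assume "\<exists>a \<in> carrier R - {\<zero>} - Units R. I = PIdl a"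
  then obtain a where a: "a \<in> carrier R" "a \<noteq> \<zero>" "a \<notin> Units R" "I = PIdl a"
    by blast
  then show "proper_nonzero_principal R I"
    using ideal_eq_carrier_iff[of a] cgenideal_is_principalideal cgenideal_self[of a]
    by (auto simp: proper_nonzero_principal_def)
qed

lemma proper_nonzero_principal_integral:
  "proper_nonzero_principal R I \<Longrightarrow> I \<in> integral_ideals R"
  by (auto simp: proper_nonzero_principal_def integral_ideals_def dest: principalideal.axioms)

lemma mem_cgenideal_iff:
  assumes "a \<in> carrier R"
  shows "x \<in> PIdl a \<longleftrightarrow> a divides x"
  using assms by (auto simp: cgenideal_def factor_def m_comm)

text \<open>The induction follows proper factors of \<open>x\<close> rather than ideals.
  \<open>I\<close> stays arbitrary because the hypothesis is applied to another ideal, one that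
  contains a proper factor of \<open>x\<close>.\<close>

lemma ideal_principal_if_covered:
  assumes "divisor_chain_condition_monoid (mult_of R)"
    and cov: "integral_ideals R \<lhd>\<^sub>P proper_nonzero_principal R"
    and "ideal I R" "x \<in> I" "x \<noteq> \<zero>"
  shows "\<exists>a \<in> carrier R. I = PIdl a"
proof -
  interpret M: divisor_chain_condition_monoid "mult_of R" by fact
  from assms(3-5) show ?thesis
  proof (induction x arbitrary: I rule: wf_induct_rule[OF M.division_wellfounded])
    case (1 x I)
    note IH = 1(1) and I = 1(2) and x = 1(3,4)
    interpret I: ideal I R by (rule I)
    have xR: "x \<in> carrier R"
      using x I.a_subset by blast
    show ?case
    proof (cases "I = carrier R")
      case True
      then show ?thesis
        using ideal_eq_carrier_iff[of \<one>] by auto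
    next
      case False
      then have "I \<in> integral_ideals R"
        using x I by (auto simp: integral_ideals_def)
      then obtain a where a: "a \<in> carrier R" "a \<noteq> \<zero>" "a \<notin> Units R" "I \<subseteq> PIdl a"
        using cov by (auto simp: covered_by_def proper_nonzero_principal_iff)
      \<comment> \<open>The colon ideal \<open>(I : a)\<close>. As
        \<open>I \<subseteq> PIdl a\<close>, multiplying it by \<open>a\<close> gives back all of
        \<open>I\<close>, so a generator of \<open>?J\<close> yields one of
        \<open>I\<close>.\<close>
      let ?J = "{d \<in> carrier R. a \<otimes> d \<in> I}"
      obtain y where y: "y \<in> carrier R" "x = a \<otimes> y"
        using a x mem_cgenideal_iff[of a x] by (auto simp: factor_def)
      have "properfactor (mult_of R) y x"
        using y a properfactor_mult_nonunit[of a y] x by auto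
      moreover have "y \<noteq> \<zero>"
        using y a x by auto
      moreover have "y \<in> ?J"
        using y x by simp
      ultimately obtain b where b: "b \<in> carrier R" "?J = PIdl b"
        using IH[of y ?J] ideal_divided_by[OF I a(1)] y(1) x(2) xR by auto
      have "I = PIdl (a \<otimes> b)"
      proof
        show "I \<subseteq> PIdl (a \<otimes> b)"
        proof
          fix z assume z: "z \<in> I"
          then obtain w where w: "w \<in> carrier R" "z = a \<otimes> w"
            using a mem_cgenideal_iff[of a z] by (auto simp: factor_def)
          then have "b divides w"
            using z b mem_cgenideal_iff[of b w] by blast
          then show "z \<in> PIdl (a \<otimes> b)"
            using w a b mem_cgenideal_iff[of "a \<otimes> b" z] divides_mult by auto
        qed
        have "b \<in> ?J"
          using b cgenideal_self by blast
        then show "PIdl (a \<otimes> b) \<subseteq> I"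
          using cgenideal_minimal[OF I] by blast
      qed
      then show ?thesis
        using a b by blast
    qed
  qed
qed

lemma principal_domain_iff_covered:
  assumes "divisor_chain_condition_monoid (mult_of R)"
  shows "principal_domain R \<longleftrightarrow> integral_ideals R \<lhd>\<^sub>P proper_nonzero_principal R"
proof
  assume "principal_domain R"
  then interpret P: principal_domain R .
  show "integral_ideals R \<lhd>\<^sub>P proper_nonzero_principal R"
    unfolding covered_by_def
  proof
    fix I assume I: "I \<in> integral_ideals R"
    then have "principalideal I R"
      using P.exists_gen cgenideal_is_principalideal by (auto simp: integral_ideals_def)
    then show "\<exists>\<gamma> \<in> integral_ideals R. I \<subseteq> \<gamma> \<and> proper_nonzero_principal R \<gamma>"
      using I by (auto simp: integral_ideals_def proper_nonzero_principal_def)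
  qed
next
  assume cov: "integral_ideals R \<lhd>\<^sub>P proper_nonzero_principal R"
  show "principal_domain R"
  proof unfold_locales
    fix I assume I: "ideal I R"
    show "\<exists>a \<in> carrier R. I = PIdl a"
    proof (cases "I = {\<zero>}")
      case True
      have "PIdl \<zero> = {\<zero>}"
        by (auto simp: cgenideal_def intro!: exI[of _ \<zero>])
      then show ?thesis
        using True by auto
    next
      case False
      \<comment> \<open>\<open>I\<close> contains zero but differs from \<open>{\<zero>}\<close>, so
        it has a nonzero element on which the induction can run.\<close>
      then show ?thesis
        using ideal_principal_if_covered[OF assms cov I] I
        by (metis additive_subgroup.zero_closed ideal_def is_singletonI' is_singleton_def singletonD empty_iff)
    qed
  qed
qed

end

section \<open>Coprime finite sets in a factorial domain\<close>

text \<open>A nonunit divisor of \<open>x\<close> that is minimal under proper divisibility has only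
  units as proper factors. It is therefore irreducible, hence prime in a factorial domain.\<close>

lemma (in factorial_domain) exists_prime_divisor:
  assumes "x \<in> carrier R" "x \<noteq> \<zero>" "x \<notin> Units R"
  obtains p where "p \<in> carrier R" "p \<noteq> \<zero>" "prime R p" "p divides x"
proof -
  let ?Q = "{z \<in> carrier R - {\<zero>} - Units R. z divides x}"
  have "x \<in> ?Q"
    using assms by auto
  then obtain z where z: "z \<in> ?Q"
    and min: "\<And>y. (y, z) \<in> {(x, y). x \<in> carrier (mult_of R) \<and> y \<in> carrier (mult_of R) \<and>
      properfactor (mult_of R) x y} \<Longrightarrow> y \<notin> ?Q"
    by (rule wfE_min[OF division_wellfounded]) (rule that)
  have "irreducible (mult_of R) z"
  proof (rule irreducibleI)
    fix b assume b: "b \<in> carrier (mult_of R)" "properfactor (mult_of R) b z"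
    then have "b divides z"
      by (auto simp: properfactor_def)
    then have "b divides x"
      using z b by (auto intro: divides_trans)
    then show "b \<in> Units (mult_of R)"
      using min[of b] b z by auto
  qed (use z in auto)
  then have "prime R z"
    using z irreducible_prime[of z] prime_eq_prime_mult by auto
  then show thesis
    using z that by blast
qed

text \<open>The conclusion says that \<open>x\<close> and the elements of \<open>Y\<close> have no common prime factor, in the form
  \<open>(1/x)D \<inter> Y\<^sup>-\<^sup>1 = D\<close>.\<close>

lemma (in factorial_domain) finite_coprime_subset:
  assumes "x \<in> carrier R" "x \<noteq> \<zero>" "I \<subseteq> carrier R"
    and "\<And>p. p \<in> carrier R \<Longrightarrow> prime R p \<Longrightarrow> p divides x \<Longrightarrow> \<exists>y \<in> I. \<not> p divides y"
  shows "\<exists>Y \<subseteq> I. finite Y \<and>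
    (\<forall>c \<in> carrier R. (\<forall>y \<in> Y. x divides (c \<otimes> y)) \<longrightarrow> x divides c)"
  using assms
proof (induction x rule: wf_induct_rule[OF division_wellfounded])
  case (1 x)
  note IH = 1(1) and x = 1(2,3) and I = 1(4) and no_common = 1(5)
  show ?case
  proof (cases "x \<in> Units R")
    case True
    \<comment> \<open>A unit divides every \<open>c\<close>, so the empty set suffices.\<close>
    then show ?thesis
      using unit_divides by (intro exI[of _ "{}"]) simp
  next
    case False
    then obtain p where p: "p \<in> carrier R" "p \<noteq> \<zero>" "prime R p" "p divides x"
      using x exists_prime_divisor by blast
    then obtain z where z: "z \<in> carrier R" "x = p \<otimes> z"
      by (auto simp: factor_def)
    have p_nonunit: "p \<notin> Units R"
      using p by (auto simp: prime_def)
    obtain y where y: "y \<in> I" "\<not> p divides y"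
      using no_common p by blast
    have pf: "properfactor (mult_of R) z x"
      using properfactor_mult_nonunit[of p z] p(1) z p_nonunit x(2) by simp
    have z0: "z \<noteq> \<zero>"
      using z(2) p(1) x(2) by auto
    have no_common_z: "\<exists>y \<in> I. \<not> q divides y" if "q \<in> carrier R" "prime R q" "q divides z" for q
    proof -
      have "q divides x"
        using that z p by (simp add: divides_prod_l)
      then show ?thesis
        using no_common that by blast
    qed
    have "(z, x) \<in> {(x, y). x \<in> carrier (mult_of R) \<and> y \<in> carrier (mult_of R) \<and>
        properfactor (mult_of R) x y}"
      using pf z0 z(1) x by simp
    from IH[OF this z(1) z0 I no_common_z] obtain Y where Y: "Y \<subseteq> I" "finite Y"
      and cop: "\<And>c. c \<in> carrier R \<Longrightarrow> \<forall>y \<in> Y. z divides (c \<otimes> y) \<Longrightarrow> z divides c"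
      by blast
    \<comment> \<open>Adding \<open>y\<close> to the set found for \<open>z = x/p\<close> takes care
      of the extra factor: \<open>p\<close> divides \<open>c \<otimes> y\<close> but not
      \<open>y\<close>, hence divides \<open>c\<close>, and cancelling \<open>p\<close> leaves the
      claim for \<open>z\<close>.\<close>
    have "x divides c" if c: "c \<in> carrier R" "\<forall>y \<in> insert y Y. x divides (c \<otimes> y)" for c
    proof -
      have yR: "y \<in> carrier R"
        using y I by blast
      have "p divides (c \<otimes> y)"
        using c p by (meson divides_trans insertI1)
      then have "p divides c"
        using p y c(1) yR by (auto simp: prime_def)
      then obtain e where e: "e \<in> carrier R" "c = p \<otimes> e"
        by (auto simp: factor_def)
      have "z divides (e \<otimes> w)" if w: "w \<in> Y" for w
      proof -
        have w': "w \<in> carrier R"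
          using w Y I by blast
        have "(p \<otimes> z) divides (p \<otimes> (e \<otimes> w))"
          using c w e z p w' by (auto simp: m_assoc)
        then show ?thesis
          using mult_divides[of z "e \<otimes> w" p] z e p w' by auto
      qed
      then show ?thesis
        using cop[of e] e z p divides_mult by auto
    qed
    then show ?thesis
      using Y y by (intro exI[of _ "insert y Y"]) auto
  qed
qed

section \<open>The v-operation and t-ideals\<close>

context quotient_field
begin

section \<open>The embedding of D into its quotient field\<close>

lemma h_closed [simp]: "a \<in> carrier D \<Longrightarrow> h a \<in> carrier K"
  using embedding by (rule ring_hom_closed)

lemma h_mult [simp]: "\<lbrakk>a \<in> carrier D; b \<in> carrier D\<rbrakk> \<Longrightarrow> h (a \<otimes>\<^bsub>D\<^esub> b) = h a \<otimes>\<^bsub>K\<^esub> h b"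
  using embedding by (rule ring_hom_mult)

lemma h_add [simp]: "\<lbrakk>a \<in> carrier D; b \<in> carrier D\<rbrakk> \<Longrightarrow> h (a \<oplus>\<^bsub>D\<^esub> b) = h a \<oplus>\<^bsub>K\<^esub> h b"
  using embedding by (rule ring_hom_add)

lemma h_one [simp]: "h \<one>\<^bsub>D\<^esub> = \<one>\<^bsub>K\<^esub>"
  using embedding by (rule ring_hom_one)

lemma h_zero [simp]: "h \<zero>\<^bsub>D\<^esub> = \<zero>\<^bsub>K\<^esub>"
  using embedding D.ring_axioms K.ring_axioms by (rule ring_hom_zero)

lemma h_minus_one: "h (\<ominus>\<^bsub>D\<^esub> \<one>\<^bsub>D\<^esub>) = \<ominus>\<^bsub>K\<^esub> \<one>\<^bsub>K\<^esub>"
proof -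
  have "h (\<ominus>\<^bsub>D\<^esub> \<one>\<^bsub>D\<^esub>) \<oplus>\<^bsub>K\<^esub> \<one>\<^bsub>K\<^esub> = \<zero>\<^bsub>K\<^esub>"
    using h_add[of "\<ominus>\<^bsub>D\<^esub> \<one>\<^bsub>D\<^esub>" "\<one>\<^bsub>D\<^esub>"] by (simp add: D.l_neg)
  then show ?thesis
    by (simp add: K.minus_equality)
qed

lemma h_eq_iff [simp]: "\<lbrakk>a \<in> carrier D; b \<in> carrier D\<rbrakk> \<Longrightarrow> h a = h b \<longleftrightarrow> a = b"
  using embedding_inj by (auto dest: inj_onD)

lemma h_eq_zero_iff [simp]: "a \<in> carrier D \<Longrightarrow> h a = \<zero>\<^bsub>K\<^esub> \<longleftrightarrow> a = \<zero>\<^bsub>D\<^esub>"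
  using h_eq_iff[of a "\<zero>\<^bsub>D\<^esub>"] by simp

section \<open>Submodules of K over D\<close>

lemma D_submoduleI:
  assumes sub: "M \<subseteq> carrier K" and zero: "\<zero>\<^bsub>K\<^esub> \<in> M"
    and add: "\<And>x y. x \<in> M \<Longrightarrow> y \<in> M \<Longrightarrow> x \<oplus>\<^bsub>K\<^esub> y \<in> M"
    and smult: "\<And>d x. d \<in> carrier D \<Longrightarrow> x \<in> M \<Longrightarrow> h d \<otimes>\<^bsub>K\<^esub> x \<in> M"
  shows "D_submodule D K h M"
  unfolding D_submodule_def
proof (intro conjI additive_subgroupI K.add.subgroupI ballI)
  \<comment> \<open>Negation is scalar multiplication by the image of minus one.\<close>
  fix x assume x: "x \<in> M"
  have "\<ominus>\<^bsub>K\<^esub> x = h (\<ominus>\<^bsub>D\<^esub> \<one>\<^bsub>D\<^esub>) \<otimes>\<^bsub>K\<^esub> x"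
    using x sub by (auto simp: h_minus_one K.l_minus)
  then show "\<ominus>\<^bsub>K\<^esub> x \<in> M"
    using smult[of "\<ominus>\<^bsub>D\<^esub> \<one>\<^bsub>D\<^esub>" x] x by simp
qed (use assms in auto)

lemma D_submoduleD:
  assumes "D_submodule D K h M"
  shows "M \<subseteq> carrier K" "\<zero>\<^bsub>K\<^esub> \<in> M"
    and "\<And>x y. x \<in> M \<Longrightarrow> y \<in> M \<Longrightarrow> x \<oplus>\<^bsub>K\<^esub> y \<in> M"
    and "\<And>d x. d \<in> carrier D \<Longrightarrow> x \<in> M \<Longrightarrow> h d \<otimes>\<^bsub>K\<^esub> x \<in> M"
  using assms
  by (auto simp: D_submodule_def additive_subgroup.a_closed additive_subgroup.zero_closed
      dest: additive_subgroup.a_subset)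

lemma D_submodule_image:
  assumes "ideal I D"
  shows "D_submodule D K h (h ` I)"
proof -
  interpret I: ideal I D by fact
  have sub: "x \<in> carrier D" if "x \<in> I" for x
    using that I.a_subset by blast
  show ?thesis
  proof (rule D_submoduleI)
    show "\<zero>\<^bsub>K\<^esub> \<in> h ` I"
      using I.zero_closed h_zero by (metis image_eqI)
  next
    fix x y assume "x \<in> h ` I" "y \<in> h ` I"
    then show "x \<oplus>\<^bsub>K\<^esub> y \<in> h ` I"
      using sub I.a_closed by (auto simp: h_add[symmetric] simp del: h_add)
  next
    fix d x assume "d \<in> carrier D" "x \<in> h ` I"
    then show "h d \<otimes>\<^bsub>K\<^esub> x \<in> h ` I"
      using sub I.I_l_closed by (auto simp: h_mult[symmetric] simp del: h_mult)
  qed (use sub in auto)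
qed

text \<open>Contraction to \<open>D\<close>; it later turns the v-closure of two elements into an
  integral ideal.\<close>

lemma ideal_vimage:
  assumes "D_submodule D K h M"
  shows "ideal {d \<in> carrier D. h d \<in> M} D"
proof -
  note M = D_submoduleD[OF assms]
  show ?thesis
  proof (intro idealI D.ring_axioms D.add.subgroupI)
    show "{d \<in> carrier D. h d \<in> M} \<noteq> {}"
      using M(2) by (auto intro!: exI[of _ "\<zero>\<^bsub>D\<^esub>"])
  next
    fix d assume d: "d \<in> {d \<in> carrier D. h d \<in> M}"
    have "\<ominus>\<^bsub>D\<^esub> d = (\<ominus>\<^bsub>D\<^esub> \<one>\<^bsub>D\<^esub>) \<otimes>\<^bsub>D\<^esub> d"
      using d by (auto simp: D.l_minus)
    then show "\<ominus>\<^bsub>D\<^esub> d \<in> {d \<in> carrier D. h d \<in> M}"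
      using d M(4)[of "\<ominus>\<^bsub>D\<^esub> \<one>\<^bsub>D\<^esub>" "h d"] by auto
  next
    fix d x assume d: "d \<in> {d \<in> carrier D. h d \<in> M}" and x: "x \<in> carrier D"
    then show "x \<otimes>\<^bsub>D\<^esub> d \<in> {d \<in> carrier D. h d \<in> M}"
      using M(4) by auto
    then show "d \<otimes>\<^bsub>D\<^esub> x \<in> {d \<in> carrier D. h d \<in> M}"
      using d x by (auto simp: D.m_comm)
  qed (use M(3) in auto)
qed

section \<open>Inverses and v-closures\<close>

lemma D_submodule_frac_inverse:
  assumes "A \<subseteq> carrier K"
  shows "D_submodule D K h (frac_inverse D K h A)"
proof -
  \<comment> \<open>The unit ideal makes the image of \<open>D\<close> a submodule. Its closure
    properties pass to the inverse of any subset \<open>A\<close>, ideal or not, so inverses can be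
    taken of bare generating sets.\<close>
  note D = D_submoduleD[OF D_submodule_image[OF D.oneideal]]
  show ?thesis
  proof (rule D_submoduleI)
    show "\<zero>\<^bsub>K\<^esub> \<in> frac_inverse D K h A"
      using assms D(2) by (auto simp: frac_inverse_def subset_iff)
  next
    fix x y assume "x \<in> frac_inverse D K h A" "y \<in> frac_inverse D K h A"
    then show "x \<oplus>\<^bsub>K\<^esub> y \<in> frac_inverse D K h A"
      using assms D(3) by (auto simp: frac_inverse_def subset_iff K.l_distr)
  next
    fix d x assume "d \<in> carrier D" "x \<in> frac_inverse D K h A"
    then show "h d \<otimes>\<^bsub>K\<^esub> x \<in> frac_inverse D K h A"
      using assms D(4) by (auto simp: frac_inverse_def subset_iff K.m_assoc)
  qed (auto simp: frac_inverse_def)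
qed

lemma frac_inverse_closed: "frac_inverse D K h A \<subseteq> carrier K"
  by (auto simp: frac_inverse_def)

lemma frac_inverse_antimono: "A \<subseteq> B \<Longrightarrow> frac_inverse D K h B \<subseteq> frac_inverse D K h A"
  by (auto simp: frac_inverse_def)

lemma v_closureD:
  "\<lbrakk>x \<in> v_closure D K h A; u \<in> frac_inverse D K h A\<rbrakk> \<Longrightarrow> x \<otimes>\<^bsub>K\<^esub> u \<in> h ` carrier D"
  by (simp add: v_closure_def frac_inverse_def[of _ _ _ "frac_inverse D K h A"])

lemma v_closure_mono: "A \<subseteq> B \<Longrightarrow> v_closure D K h A \<subseteq> v_closure D K h B"
  by (simp add: v_closure_def frac_inverse_antimono)

lemma subset_v_closure:
  assumes "A \<subseteq> carrier K"
  shows "A \<subseteq> v_closure D K h A"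
  using assms by (auto simp: v_closure_def frac_inverse_def K.m_comm subset_iff)

text \<open>Inversion is an antitone Galois connection, so three inverses collapse to one:
  extensivity of the v-closure is used for \<open>A\<close> and for the inverse of
  \<open>A\<close>.\<close>

lemma frac_inverse_v_closure:
  assumes "A \<subseteq> carrier K"
  shows "frac_inverse D K h (v_closure D K h A) = frac_inverse D K h A"
  using frac_inverse_antimono[OF subset_v_closure[OF assms]]
    subset_v_closure[OF frac_inverse_closed, of A]
  by (auto simp: v_closure_def)

text \<open>The inverse of \<open>A\<close> contains one, and pairing an element of the v-closure
  with one puts it into the image of \<open>D\<close>.\<close>

lemma v_closure_integral:
  assumes "A \<subseteq> h ` carrier D"
  shows "v_closure D K h A \<subseteq> h ` carrier D"
proof
  fix x assume x: "x \<in> v_closure D K h A"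
  have "\<one>\<^bsub>K\<^esub> \<in> frac_inverse D K h A"
    using assms by (auto simp: frac_inverse_def subset_iff)
  then show "x \<in> h ` carrier D"
    using x by (auto simp: v_closure_def frac_inverse_def)
qed

lemma one_mem_v_closure:
  assumes "frac_inverse D K h A \<subseteq> h ` carrier D"
  shows "\<one>\<^bsub>K\<^esub> \<in> v_closure D K h A"
proof -
  have "\<one>\<^bsub>K\<^esub> \<otimes>\<^bsub>K\<^esub> u \<in> h ` carrier D" if "u \<in> frac_inverse D K h A" for u
    using that assms frac_inverse_closed[of A] by (metis K.l_one subsetD)
  then show ?thesis
    by (simp add: v_closure_def frac_inverse_def[of _ _ _ "frac_inverse D K h A"])
qed

section \<open>Spans and their inverses\<close>

definition D_span :: "'c set \<Rightarrow> 'c set" where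
  "D_span A = \<Inter> {M. D_submodule D K h M \<and> A \<subseteq> M}"

lemma D_span_minimal: "D_submodule D K h M \<Longrightarrow> A \<subseteq> M \<Longrightarrow> D_span A \<subseteq> M"
  by (auto simp: D_span_def)

lemma subset_D_span: "A \<subseteq> D_span A"
  by (auto simp: D_span_def)

lemma D_submodule_D_span:
  assumes "A \<subseteq> carrier K"
  shows "D_submodule D K h (D_span A)"
proof (rule D_submoduleI)
  have "D_submodule D K h (carrier K)"
    by (rule D_submoduleI) auto
  then show "D_span A \<subseteq> carrier K"
    using D_span_minimal assms by blast
qed (auto simp: D_span_def intro: D_submoduleD)

text \<open>The v-closure of \<open>A\<close> is a submodule containing \<open>A\<close>, so it
  contains the span, and it has the same inverse as \<open>A\<close>. Hence v-closures depend only
  on generators.\<close>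

lemma frac_inverse_D_span:
  assumes "A \<subseteq> carrier K"
  shows "frac_inverse D K h (D_span A) = frac_inverse D K h A"
proof
  show "frac_inverse D K h (D_span A) \<subseteq> frac_inverse D K h A"
    using frac_inverse_antimono subset_D_span by blast
  have "D_span A \<subseteq> v_closure D K h A"
    unfolding v_closure_def using D_submodule_frac_inverse[OF frac_inverse_closed]
      subset_v_closure[OF assms] by (intro D_span_minimal) (auto simp: v_closure_def)
  then show "frac_inverse D K h A \<subseteq> frac_inverse D K h (D_span A)"
    using frac_inverse_antimono frac_inverse_v_closure[OF assms] by blast
qed

section \<open>t-closures and t-ideals\<close>

lemma fractional_ideal_integral:
  assumes "D_submodule D K h M" "M \<subseteq> h ` carrier D"
  shows "fractional_ideal D K h M"
  \<comment> \<open>The common denominator is one.\<close>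
  using assms unfolding fractional_ideal_def
  by (intro conjI bexI[of _ "\<one>\<^bsub>D\<^esub>"]) (auto simp: subset_iff)

text \<open>Lets finite sets stand in for the finitely generated ideals in the union defining the
  t-closure: the span of \<open>A\<close> has the same v-closure, and a nonzero element of
  \<open>A\<close> keeps it from being the zero ideal.\<close>

lemma v_closure_subset_t_closure:
  assumes "ideal I D" "finite A" "A \<subseteq> h ` I" "\<not> A \<subseteq> {\<zero>\<^bsub>K\<^esub>}"
  shows "v_closure D K h A \<subseteq> t_closure D K h (h ` I)"
proof -
  have I: "h ` I \<subseteq> h ` carrier D"
    using ideal.axioms(1)[OF assms(1)] additive_subgroup.a_subset by blast
  moreover have "h ` carrier D \<subseteq> carrier K"
    by (rule image_subsetI) (rule h_closed)
  ultimately have A: "A \<subseteq> carrier K"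
    using assms(3) by (meson subset_trans)
  have span: "D_span A \<subseteq> h ` I"
    by (rule D_span_minimal[OF D_submodule_image[OF assms(1)] assms(3)])
  have "D_span A \<noteq> {\<zero>\<^bsub>K\<^esub>}"
    using subset_D_span[of A] assms(4) by auto
  moreover have "fractional_ideal D K h (D_span A)"
    using D_submodule_D_span[OF A] span I by (intro fractional_ideal_integral) auto
  moreover have "finitely_generated D K h (D_span A)"
    using A assms(2) by (auto simp: finitely_generated_def D_span_def)
  moreover have "v_closure D K h A = v_closure D K h (D_span A)"
    using frac_inverse_D_span[OF A] by (simp add: v_closure_def)
  ultimately show ?thesis
    using span unfolding t_closure_def by blast
qed

text \<open>The t-closure of a nonzero ideal lies between the ideal and its v-closure, so being
  closed under v is enough.\<close>

lemma t_idealI: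
  assumes "ideal I D" "I \<noteq> {\<zero>\<^bsub>D\<^esub>}" "v_closure D K h (h ` I) \<subseteq> h ` I"
  shows "t_ideal D K h (h ` I)"
proof -
  interpret I: ideal I D by fact
  have sub: "I \<subseteq> carrier D"
    by (rule I.a_subset)
  then obtain w where w: "w \<in> I" "w \<in> carrier D" "w \<noteq> \<zero>\<^bsub>D\<^esub>"
    using I.zero_closed assms(2) by blast
  have "t_closure D K h (h ` I) \<subseteq> h ` I"
    using assms(3) v_closure_mono[of _ "h ` I"] unfolding t_closure_def by blast
  moreover have "h ` I \<subseteq> t_closure D K h (h ` I)"
  proof
    fix z assume z: "z \<in> h ` I"
    \<comment> \<open>The nonzero \<open>h w\<close> is adjoined because \<open>z\<close> may be
      zero, and the zero ideal is excluded from the union.\<close>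
    have "{z, h w} \<subseteq> carrier K"
      using z sub w(2) by auto
    then have "z \<in> v_closure D K h {z, h w}"
      using subset_v_closure by blast
    then show "z \<in> t_closure D K h (h ` I)"
      using v_closure_subset_t_closure[OF assms(1), of "{z, h w}"] z w by fastforce
  qed
  moreover have "fractional_ideal D K h (h ` I)"
    using D_submodule_image[OF assms(1)] sub by (intro fractional_ideal_integral) auto
  moreover have "h ` I \<noteq> {\<zero>\<^bsub>K\<^esub>}"
    using w h_eq_zero_iff[of w] by blast
  ultimately show ?thesis
    by (auto simp: t_ideal_def)
qed

text \<open>The inverse of the ideal contains \<open>1/a\<close>, so \<open>x/a\<close> lies in
  \<open>D\<close> for every \<open>x\<close> in the v-closure. This makes principal ideals
  available as covers among the t-ideals.\<close>

lemma t_ideal_cgenideal: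
  assumes a: "a \<in> carrier D" "a \<noteq> \<zero>\<^bsub>D\<^esub>"
  shows "t_ideal D K h (h ` (PIdl\<^bsub>D\<^esub> a))"
proof (rule t_idealI)
  show "PIdl\<^bsub>D\<^esub> a \<noteq> {\<zero>\<^bsub>D\<^esub>}"
    using a D.cgenideal_self by blast
  have ha: "h a \<in> Units K"
    using a K.field_Units by auto
  have "inv\<^bsub>K\<^esub> (h a) \<in> frac_inverse D K h (h ` (PIdl\<^bsub>D\<^esub> a))"
    using a ha by (auto simp: frac_inverse_def cgenideal_def K.m_lcomm)
  then show "v_closure D K h (h ` (PIdl\<^bsub>D\<^esub> a)) \<subseteq> h ` (PIdl\<^bsub>D\<^esub> a)"
  proof (intro subsetI)
    fix x assume inv: "inv\<^bsub>K\<^esub> (h a) \<in> frac_inverse D K h (h ` (PIdl\<^bsub>D\<^esub> a))"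
      and x: "x \<in> v_closure D K h (h ` (PIdl\<^bsub>D\<^esub> a))"
    then obtain d where d: "d \<in> carrier D" "x \<otimes>\<^bsub>K\<^esub> inv\<^bsub>K\<^esub> (h a) = h d"
      by (auto simp: v_closure_def frac_inverse_def)
    have "x \<in> carrier K"
      using x by (auto simp: v_closure_def frac_inverse_def)
    then have "x = h (d \<otimes>\<^bsub>D\<^esub> a)"
      using a ha d by (auto simp: d(2)[symmetric] K.m_assoc)
    then show "x \<in> h ` (PIdl\<^bsub>D\<^esub> a)"
      using d by (auto simp: cgenideal_def)
  qed
qed (use D.cgenideal_ideal a in auto)

section \<open>The UFD criterion\<close>

lemma covered_if_factorial:
  assumes "factorial_domain D"
  shows "integral_t_ideals D K h \<lhd>\<^sub>P proper_nonzero_principal D"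
  unfolding covered_by_def
proof
  interpret F: factorial_domain D by fact
  fix I assume "I \<in> integral_t_ideals D K h"
  then have idl: "ideal I D" and I: "I \<noteq> {\<zero>\<^bsub>D\<^esub>}" "I \<noteq> carrier D"
    and t: "t_closure D K h (h ` I) = h ` I"
    by (auto simp: integral_t_ideals_def integral_ideals_def t_ideal_def)
  interpret I: ideal I D by fact
  have sub: "I \<subseteq> carrier D"
    by (rule I.a_subset)
  then obtain x where x: "x \<in> I" "x \<in> carrier D" "x \<noteq> \<zero>\<^bsub>D\<^esub>"
    using I.zero_closed I by blast
  \<comment> \<open>Restricting to prime divisors of one nonzero \<open>x \<in> I\<close> makes
    \<open>finite_coprime_subset\<close> applicable.\<close>
  have "\<exists>p \<in> carrier D. prime D p \<and> p divides\<^bsub>D\<^esub> x \<and> (\<forall>y \<in> I. p divides\<^bsub>D\<^esub> y)"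
  proof (rule ccontr)
    assume "\<not> ?thesis"
    then obtain Y where Y: "Y \<subseteq> I" "finite Y"
      and cop: "\<And>c. c \<in> carrier D \<Longrightarrow> \<forall>y \<in> Y. x divides\<^bsub>D\<^esub> (c \<otimes>\<^bsub>D\<^esub> y) \<Longrightarrow> x divides\<^bsub>D\<^esub> c"
      using F.finite_coprime_subset[OF x(2,3) sub] by blast
    let ?A = "h ` insert x Y"
    \<comment> \<open>For \<open>u\<close> in the inverse, \<open>c = ux\<close> and all
      \<open>uy\<close> lie in \<open>D\<close>, and \<open>cy = x(uy)\<close> shows that
      \<open>x\<close> divides \<open>cy\<close> for \<open>y \<in> Y\<close>. Coprimality makes
      \<open>x\<close> divide \<open>c\<close>, so \<open>u = c/x\<close> is in
      \<open>D\<close>.\<close>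
    have "frac_inverse D K h ?A \<subseteq> h ` carrier D"
    proof
      fix u assume u: "u \<in> frac_inverse D K h ?A"
      then have uK: "u \<in> carrier K"
        by (simp add: frac_inverse_def)
      obtain c where c: "c \<in> carrier D" "u \<otimes>\<^bsub>K\<^esub> h x = h c"
        using u by (auto simp: frac_inverse_def)
      have "x divides\<^bsub>D\<^esub> (c \<otimes>\<^bsub>D\<^esub> y)" if y: "y \<in> Y" for y
      proof -
        have yD: "y \<in> carrier D"
          using y Y sub by blast
        obtain e where e: "e \<in> carrier D" "u \<otimes>\<^bsub>K\<^esub> h y = h e"
          using u y by (auto simp: frac_inverse_def)
        have "h (c \<otimes>\<^bsub>D\<^esub> y) = u \<otimes>\<^bsub>K\<^esub> h x \<otimes>\<^bsub>K\<^esub> h y"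
          using c yD by simp
        also have "\<dots> = h x \<otimes>\<^bsub>K\<^esub> (u \<otimes>\<^bsub>K\<^esub> h y)"
          using uK x yD by (simp add: K.m_ac)
        also have "\<dots> = h (x \<otimes>\<^bsub>D\<^esub> e)"
          using e x by simp
        finally have "c \<otimes>\<^bsub>D\<^esub> y = x \<otimes>\<^bsub>D\<^esub> e"
          using c e x yD by (simp del: h_mult)
        then show ?thesis
          using e by (auto simp: factor_def)
      qed
      then obtain d where d: "d \<in> carrier D" "c = x \<otimes>\<^bsub>D\<^esub> d"
        using cop[OF c(1)] by (auto simp: factor_def)
      then have "h x \<otimes>\<^bsub>K\<^esub> u = h x \<otimes>\<^bsub>K\<^esub> h d"
        using c x uK by (simp add: K.m_comm)
      then have "u = h d"
        using K.m_lcancel[of "h x" u "h d"] x uK d by auto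
      then show "u \<in> h ` carrier D"
        using d by blast
    qed
    then have "\<one>\<^bsub>K\<^esub> \<in> v_closure D K h ?A"
      by (rule one_mem_v_closure)
    moreover have "v_closure D K h ?A \<subseteq> h ` I"
    proof -
      have "?A \<subseteq> h ` I" "finite ?A"
        using Y x(1) by auto
      moreover have "\<not> ?A \<subseteq> {\<zero>\<^bsub>K\<^esub>}"
        using x(2,3) by simp
      ultimately show ?thesis
        using v_closure_subset_t_closure[OF idl] t by blast
    qed
    ultimately obtain d where "d \<in> I" "h d = \<one>\<^bsub>K\<^esub>"
      by (metis imageE subsetD)
    then have "\<one>\<^bsub>D\<^esub> \<in> I"
      using h_eq_iff[of d "\<one>\<^bsub>D\<^esub>"] sub by auto
    then show False
      using I I.one_imp_carrier by blast
  qed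
  then obtain p where p: "p \<in> carrier D" "prime D p" "p divides\<^bsub>D\<^esub> x"
    and all: "\<forall>y \<in> I. p divides\<^bsub>D\<^esub> y"
    by blast
  have p0: "p \<noteq> \<zero>\<^bsub>D\<^esub>"
    using p x D.zero_divides by blast
  moreover have "p \<notin> Units D"
    using p by (auto simp: prime_def)
  ultimately have principal: "proper_nonzero_principal D (PIdl\<^bsub>D\<^esub> p)"
    using p D.proper_nonzero_principal_iff by auto
  then have "PIdl\<^bsub>D\<^esub> p \<in> integral_t_ideals D K h"
    using t_ideal_cgenideal[OF p(1) p0] D.proper_nonzero_principal_integral
    by (auto simp: integral_t_ideals_def)
  moreover have "I \<subseteq> PIdl\<^bsub>D\<^esub> p"
    using all D.mem_cgenideal_iff[OF p(1)] by blast
  ultimately show "\<exists>\<gamma> \<in> integral_t_ideals D K h. I \<subseteq> \<gamma> \<and> proper_nonzero_principal D \<gamma>"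
    using principal by blast
qed

lemma irreducible_prime_if_covered:
  assumes cov: "integral_t_ideals D K h \<lhd>\<^sub>P proper_nonzero_principal D"
    and p: "p \<in> carrier D" "p \<noteq> \<zero>\<^bsub>D\<^esub>" and irr: "irreducible D p"
  shows "prime D p"
proof (rule primeI)
  show "p \<notin> Units D"
    using irr by (auto simp: irreducible_def)
next
  fix a b assume a: "a \<in> carrier D" and b: "b \<in> carrier D" and dvd: "p divides\<^bsub>D\<^esub> (a \<otimes>\<^bsub>D\<^esub> b)"
  let ?A = "{h p, h a}"
  \<comment> \<open>\<open>(p, a)\<^sub>v\<close> contracted to \<open>D\<close>; nothing is lost,
    since \<open>p\<close> and \<open>a\<close> lie in \<open>D\<close> and so the v-closure stays
    inside the image of \<open>D\<close>.\<close>
  let ?I = "{d \<in> carrier D. h d \<in> v_closure D K h ?A}"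
  have A: "?A \<subseteq> carrier K" "?A \<subseteq> h ` carrier D"
    using a p by auto
  have idl: "ideal ?I D"
    unfolding v_closure_def by (intro ideal_vimage D_submodule_frac_inverse frac_inverse_closed)
  have img: "h ` ?I = v_closure D K h ?A"
    using v_closure_integral[OF A(2)] by auto
  have gens: "p \<in> ?I" "a \<in> ?I"
    using subset_v_closure[OF A(1)] a p by auto
  show "p divides\<^bsub>D\<^esub> a \<or> p divides\<^bsub>D\<^esub> b"
  proof (cases "?I = carrier D")
    case True
    obtain d where d: "d \<in> carrier D" "a \<otimes>\<^bsub>D\<^esub> b = p \<otimes>\<^bsub>D\<^esub> d"
      using dvd by (auto simp: factor_def)
    have hp: "h p \<in> Units K"
      using p K.field_Units by auto
    \<comment> \<open>The fraction \<open>b/p\<close>: its products with \<open>p\<close> and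
      \<open>a\<close> are \<open>b\<close> and \<open>ab/p = d\<close>, so it lies in the inverse
      of \<open>?A\<close>.\<close>
    let ?u = "inv\<^bsub>K\<^esub> (h p) \<otimes>\<^bsub>K\<^esub> h b"
    have u: "?u \<in> carrier K"
      using hp b by auto
    have "?u \<otimes>\<^bsub>K\<^esub> h p = h b"
      using hp b p by (simp add: K.m_ac)
    moreover have "?u \<otimes>\<^bsub>K\<^esub> h a = inv\<^bsub>K\<^esub> (h p) \<otimes>\<^bsub>K\<^esub> h (a \<otimes>\<^bsub>D\<^esub> b)"
      using hp a b by (simp add: K.m_ac)
    then have "?u \<otimes>\<^bsub>K\<^esub> h a = h d"
      using hp p d by (simp add: d(2) K.m_assoc[symmetric] del: h_mult) (simp add: K.m_assoc[symmetric])
    ultimately have "?u \<in> frac_inverse D K h ?A"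
      using u b d by (auto simp: frac_inverse_def)
    moreover have "\<one>\<^bsub>K\<^esub> \<in> v_closure D K h ?A"
      using True img by (metis D.one_closed h_one image_eqI)
    \<comment> \<open>An element of the inverse pairs with one, which is in the v-closure, to give
      an element of \<open>D\<close>; thus \<open>b/p\<close> is in \<open>D\<close>.\<close>
    ultimately have "\<one>\<^bsub>K\<^esub> \<otimes>\<^bsub>K\<^esub> ?u \<in> h ` carrier D"
      by (metis v_closureD)
    then obtain e where e: "e \<in> carrier D" "?u = h e"
      using u by auto
    then have "h b = h (e \<otimes>\<^bsub>D\<^esub> p)"
      using \<open>?u \<otimes>\<^bsub>K\<^esub> h p = h b\<close> p by simp
    then have "b = p \<otimes>\<^bsub>D\<^esub> e"
      using h_eq_iff[of b "e \<otimes>\<^bsub>D\<^esub> p"] b e p by (simp add: D.m_comm)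
    then show ?thesis
      using e by (auto simp: factor_def)
  next
    case False
    have nz: "?I \<noteq> {\<zero>\<^bsub>D\<^esub>}"
      using gens p by blast
    \<comment> \<open>The collapse of three inverses makes the v-closure idempotent, so
      \<open>?I\<close> qualifies as a t-ideal.\<close>
    have "v_closure D K h (h ` ?I) \<subseteq> h ` ?I"
      unfolding img using frac_inverse_v_closure[OF A(1)]
      by (simp add: v_closure_def)
    then have "?I \<in> integral_t_ideals D K h"
      using t_idealI[OF idl nz] idl nz False
      by (simp add: integral_t_ideals_def integral_ideals_def)
    then obtain c where c: "c \<in> carrier D" "c \<notin> Units D" "?I \<subseteq> PIdl\<^bsub>D\<^esub> c"
      using cov unfolding covered_by_def D.proper_nonzero_principal_iff by blast
    then have cp: "c divides\<^bsub>D\<^esub> p" and ca: "c divides\<^bsub>D\<^esub> a"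
      using gens D.mem_cgenideal_iff by blast+
    \<comment> \<open>Otherwise the nonunit \<open>c\<close> would be a proper factor of the
      irreducible \<open>p\<close>.\<close>
    then have "p divides\<^bsub>D\<^esub> c"
      using irr c by (auto simp: irreducible_def properfactor_def)
    then show ?thesis
      using D.divides_trans ca p by blast
  qed
qed

lemma factorial_domain_iff_covered:
  assumes "divisor_chain_condition_monoid (mult_of D)"
  shows "factorial_domain D \<longleftrightarrow> integral_t_ideals D K h \<lhd>\<^sub>P proper_nonzero_principal D"
proof
  assume cov: "integral_t_ideals D K h \<lhd>\<^sub>P proper_nonzero_principal D"
  have "primeness_condition_monoid (mult_of D)"
  proof unfold_locales
    fix p assume "p \<in> carrier (mult_of D)" "irreducible (mult_of D) p"
    then show "prime (mult_of D) p"
      using irreducible_prime_if_covered[OF cov] D.irreducible_mult_imp_irreducible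
        D.prime_eq_prime_mult by auto
  qed
  \<comment> \<open>The divisor chain condition together with primeness of irreducibles
    characterizes factorial monoids.\<close>
  then have "factorial_monoid (mult_of D)"
    using factorial_condition_one assms by blast
  then show "factorial_domain D"
    by (intro factorial_domain.intro D.domain_axioms)
qed (rule covered_if_factorial)

end

theorem proposition6:
  fixes D :: "('a, 'c) ring_scheme"
    and K :: "('b, 'd) ring_scheme"
    and h :: "'a \<Rightarrow> 'b"
  assumes "domain D"
    and "\<not> field D"
    and "quotient_field D K h"
    and "ACCP D"
  shows "(principal_domain D \<longleftrightarrow> integral_ideals D \<lhd>\<^sub>P proper_nonzero_principal D) \<and>
    (factorial_domain D \<longleftrightarrow> integral_t_ideals D K h \<lhd>\<^sub>P proper_nonzero_principal D)"
  using domain.principal_domain_iff_covered[OF assms(1)]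
    quotient_field.factorial_domain_iff_covered[OF assms(3)]
    domain.ACCP_imp_divisor_chain_condition[OF assms(1,4)]
  by blast

end
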